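(* Let $n \ge 1$ and let $S_1, S_2 \subset \mathbb{Z}^n$ be $n$-dimensional skew shapes (with chosen embeddings in $\mathbb{Z}^n$). Then there is an isomorphism of $\mathbb{P}_n$-modules $$M_{S_1} \wedge M_{S_2} \;\simeq\; \bigoplus_{t \in \mathbb{Z}^n} M_{S_1 \cap (S_2 + t)}.$$
   Context: $\mathbb{P}_n = \langle x_1,\dots,x_n\rangle = \{x^r = x_1^{r_1}\cdots x_n^{r_n} : r \in \mathbb{Z}_{\ge 0}^n\} \cup \{0\}$ is the commutative monoid of monomials with an absorbing zero element, with $x^r x^s = x^{r+s}$ and $x^0 = 1$. A $\mathbb{P}_n$-module is a pointed set $(M, 0_M)$ with a map $\mathbb{P}_n \times M \to M$ satisfying $(ab)\cdot m = a\cdot(b\cdot m)$, $1\cdot m = m$, $0\cdot m = 0_M$, $a\cdot 0_M = 0_M$. A morphism is a basepoint-preserving map commuting with the action. The direct sum $\bigoplus_i M_i$ is the coproduct, i.e. the wedge sum $\bigvee_i M_i$ (disjoint union with all basepoints identified) with the evident action. The smash product is $M \wedge N = (M \times N)/(M \vee N)$, i.e. the pointed set obtained from $M\times N$ by identifying all pairs $(m,0_N)$ and $(0_M,n)$ with the basepoint, with the diagonal action $a\cdot(m,n) = (a\cdot m, a\cdot n)$. $\mathbb{Z}^n$ carries the partial order $x \le y \iff x_i \le y_i$ for all $i$. An $n$-dimensional skew shape is a finite convex sub-poset $S \subset \mathbb{Z}^n$ (convex: $a, b \in S$ and $a \le c \le b$ imply $c \in S$); it need not be connected and may be empty. For $t\in\mathbb{Z}^n$,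 $S+t$ denotes the translate $\{s+t : s\in S\}$. For a skew shape $S$, $M_S$ is the $\mathbb{P}_n$-module with underlying pointed set $S \sqcup \{0\}$ (basepoint $0$) and action, for $e \in \mathbb{Z}_{\ge 0}^n$ and $s \in S$, given by $x^e \cdot s = s + e$ if $s + e \in S$, and $x^e\cdot s = 0$ otherwise. In particular $M_{\emptyset}$ is the zero module. An intersection of translates of skew shapes is a (possibly empty) skew shape, and $S_1 \cap (S_2+t)$ is empty for all but finitely many $t$, so the right-hand side is a finite module. *)

theory Defs
  imports "HOL-Analysis.Analysis"
begin

text \<open>The monoid \<open>\<bbbP>\<^sub>n\<close> for \<open>n = CARD('n)\<close>: \<open>Monom r\<close> is \<open>x\<^sup>r\<close> and \<open>Zero\<close> is the absorbing element.\<close>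

datatype ('n::finite) pmonoid = Zero | Monom "nat ^ 'n"

instantiation pmonoid :: (finite) "{comm_monoid_mult, mult_zero}"
begin

definition zero_pmonoid :: "'a pmonoid" where
  "0 = Zero"

definition one_pmonoid :: "'a pmonoid" where
  "1 = Monom 0"

fun times_pmonoid :: "'a pmonoid \<Rightarrow> 'a pmonoid \<Rightarrow> 'a pmonoid" where
  "Monom r * Monom s = Monom (r + s)"
| "Zero * b = Zero"
| "a * Zero = Zero"

instance
proof
  fix a b c :: "'a pmonoid"
  show "a * b * c = a * (b * c)"
    by (cases a; cases b; cases c) (auto simp: add.assoc)
  show "a * b = b * a"
    by (cases a; cases b) (auto simp: add.commute)
  show "1 * a = a"
    by (cases a) (auto simp: one_pmonoid_def)
  show "0 * a = 0" "a * 0 = 0"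
    by (cases a; simp add: zero_pmonoid_def)+
qed

end

record ('n, 'm) pset =
  carr :: "'m set"
  pt :: 'm
  act :: "('n::finite) pmonoid \<Rightarrow> 'm \<Rightarrow> 'm"

locale pmodule =
  fixes M :: "('n::finite, 'm) pset"
  assumes pt_closed: "pt M \<in> carr M"
    and act_closed: "m \<in> carr M \<Longrightarrow> act M a m \<in> carr M"
    and act_mult: "m \<in> carr M \<Longrightarrow> act M (a * b) m = act M a (act M b m)"
    and act_one: "m \<in> carr M \<Longrightarrow> act M 1 m = m"
    and act_zero: "m \<in> carr M \<Longrightarrow> act M 0 m = pt M"
    and act_pt: "act M a (pt M) = pt M"

locale pmodule_hom = M: pmodule M + N: pmodule N
  for M :: "('n::finite, 'm) pset" and N :: "('n, 'k) pset" and f :: "'m \<Rightarrow> 'k" +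
  assumes hom_closed: "m \<in> carr M \<Longrightarrow> f m \<in> carr N"
    and hom_pt: "f (pt M) = pt N"
    and hom_act: "m \<in> carr M \<Longrightarrow> f (act M a m) = act N a (f m)"

definition pmodule_iso :: "('n::finite, 'm) pset \<Rightarrow> ('n, 'k) pset \<Rightarrow> bool" (infix "\<simeq>\<^sub>P" 50) where
  "M \<simeq>\<^sub>P N \<longleftrightarrow>
    (\<exists>f g. pmodule_hom M N f \<and> pmodule_hom N M g \<and>
      (\<forall>m\<in>carr M. g (f m) = m) \<and> (\<forall>k\<in>carr N. f (g k) = k))"

text \<open>\<open>collapse X A\<close> is the quotient \<open>X / A\<close> in which all points of \<open>A\<close> are identified;
  for the induced action to be well defined, \<open>A\<close> has to be stable under the action on \<open>X\<close>.\<close>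

definition collapse_rel :: "'m set \<Rightarrow> 'm set \<Rightarrow> ('m \<times> 'm) set" where
  "collapse_rel X A = {(x, y). x \<in> X \<and> y \<in> X \<and> (x = y \<or> x \<in> A \<and> y \<in> A)}"

definition collapse :: "('n::finite, 'm) pset \<Rightarrow> 'm set \<Rightarrow> ('n, 'm set) pset" where
  "collapse X A =
    \<lparr>carr = carr X // collapse_rel (carr X) A,
     pt = collapse_rel (carr X) A `` {pt X},
     act = (\<lambda>a c. collapse_rel (carr X) A `` (act X a ` c))\<rparr>"

definition pset_prod :: "('n::finite, 'm) pset \<Rightarrow> ('n, 'k) pset \<Rightarrow> ('n, 'm \<times> 'k) pset" where
  "pset_prod M N =
    \<lparr>carr = carr M \<times> carr N,
     pt = (pt M, pt N),
     act = (\<lambda>a (m, k). (act M a m, act N a k))\<rparr>"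

definition smash :: "('n::finite, 'm) pset \<Rightarrow> ('n, 'k) pset \<Rightarrow> ('n, ('m \<times> 'k) set) pset"
    (infixl "\<and>\<^sub>P" 70) where
  "M \<and>\<^sub>P N = collapse (pset_prod M N) (carr M \<times> {pt N} \<union> {pt M} \<times> carr N)"

text \<open>The disjoint union carries an additional point \<open>None\<close>, identified below with the
  basepoints of all summands, so that the empty direct sum is the one-point module.\<close>

definition disjoint_union :: "'i set \<Rightarrow> ('i \<Rightarrow> ('n::finite, 'm) pset) \<Rightarrow> ('n, ('i \<times> 'm) option) pset" where
  "disjoint_union I M =
    \<lparr>carr = insert None (Some ` (SIGMA i:I. carr (M i))),
     pt = None,
     act = (\<lambda>a. map_option (\<lambda>(i, m). (i, act (M i) a m)))\<rparr>"

definition direct_sum :: "'i set \<Rightarrow> ('i \<Rightarrow> ('n::finite, 'm) pset) \<Rightarrow> ('n, ('i \<times> 'm) option set) pset" where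
  "direct_sum I M = collapse (disjoint_union I M) (insert None ((\<lambda>i. Some (i, pt (M i))) ` I))"

text \<open>The order on \<^typ>\<open>int ^ 'n\<close> is the componentwise one.\<close>

definition skew_shape :: "(int ^ 'n::finite) set \<Rightarrow> bool" where
  "skew_shape S \<longleftrightarrow>
    finite S \<and> (\<forall>a\<in>S. \<forall>b\<in>S. \<forall>c. a \<le> c \<and> c \<le> b \<longrightarrow> c \<in> S)"

definition translate :: "(int ^ 'n::finite) set \<Rightarrow> int ^ 'n \<Rightarrow> (int ^ 'n) set" where
  "translate S t = (\<lambda>s. s + t) ` S"

definition vec_int :: "nat ^ 'n \<Rightarrow> int ^ ('n::finite)" where
  "vec_int e = (\<chi> i. int (e $ i))"

text \<open>In \<open>shape_module S\<close>, which is \<open>M\<^sub>S\<close>, \<open>None\<close> is the basepoint.\<close>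

fun shape_act :: "(int ^ 'n::finite) set \<Rightarrow> 'n pmonoid \<Rightarrow> (int ^ 'n) option \<Rightarrow> (int ^ 'n) option" where
  "shape_act S (Monom e) (Some s) = (if s + vec_int e \<in> S then Some (s + vec_int e) else None)"
| "shape_act S Zero m = None"
| "shape_act S a None = None"

definition shape_module :: "(int ^ 'n::finite) set \<Rightarrow> ('n, (int ^ 'n) option) pset" where
  "shape_module S = \<lparr>carr = insert None (Some ` S), pt = None, act = shape_act S\<rparr>"

end

theory Submission
  imports Defs
begin

text \<open>
  A pair \<open>(s\<^sub>1, s\<^sub>2) \<in> S\<^sub>1 \<times> S\<^sub>2\<close> is sent to the point \<open>s\<^sub>1\<close> of the summand with index \<open>t = s\<^sub>1 - s\<^sub>2\<close>.
  The diagonal action leaves the difference \<open>t\<close> unchanged, and it keeps both coordinates inside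
  their shapes exactly when \<open>s\<^sub>1 + e \<in> S\<^sub>1 \<inter> (S\<^sub>2 + t)\<close>.  Convexity is what makes \<open>M\<^sub>S\<close> a module.
\<close>

section \<open>Collapsing a stable subset, and maps between such quotients\<close>

lemma equiv_collapse_rel: "equiv X (collapse_rel X A)"
  unfolding collapse_rel_def by (intro equivI) (auto simp: refl_on_def sym_def trans_def)

lemma collapse_class_eq_iff:
  assumes "x \<in> X" "y \<in> X"
  shows "collapse_rel X A `` {x} = collapse_rel X A `` {y} \<longleftrightarrow> x = y \<or> x \<in> A \<and> y \<in> A"
  using eq_equiv_class_iff[OF equiv_collapse_rel assms, of A] assms
  by (simp add: collapse_rel_def)

text \<open>Since \<open>h\<close> carries \<open>A\<close> into \<open>B\<close>, the image of a
  class lies inside a single class of the target, and saturating it recovers that class. Taking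
  \<open>h\<close> to be an action map yields the induced action; taking it to be a map between two
  sets yields the induced map of quotients.\<close>

lemma collapse_class_image:
  assumes "h \<in> X \<rightarrow> Y" "h \<in> A \<rightarrow> B" "x \<in> X"
  shows "collapse_rel Y B `` (h ` (collapse_rel X A `` {x})) = collapse_rel Y B `` {h x}"
  using assms unfolding collapse_rel_def by (auto simp: Pi_iff)

lemma carr_collapse: "carr (collapse X A) = (\<lambda>x. collapse_rel (carr X) A `` {x}) ` carr X"
  by (auto simp: collapse_def quotient_def)

lemma pt_collapse: "pt (collapse X A) = collapse_rel (carr X) A `` {pt X}"
  by (simp add: collapse_def)

text \<open>The disjoint union is not itself a module, since \<open>0\<close> acts by sending each summand to its own
  basepoint; hence the condition on \<open>act X 0\<close> holds only up to \<open>A\<close>.\<close>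

locale collapsible =
  fixes X :: "('n::finite, 'm) pset" and A :: "'m set"
  assumes pt_closed: "pt X \<in> carr X"
    and pt_in: "pt X \<in> A"
    and act_closed: "m \<in> carr X \<Longrightarrow> act X a m \<in> carr X"
    and act_stable: "m \<in> A \<Longrightarrow> act X a m \<in> A"
    and act_mult: "m \<in> carr X \<Longrightarrow> act X (a * b) m = act X a (act X b m)"
    and act_one: "m \<in> carr X \<Longrightarrow> act X 1 m = m"
    and act_zero: "m \<in> carr X \<Longrightarrow> act X 0 m \<in> A"
begin

lemma act_class:
  assumes "m \<in> carr X"
  shows "act (collapse X A) a (collapse_rel (carr X) A `` {m}) = collapse_rel (carr X) A `` {act X a m}"
proof -
  have "collapse_rel (carr X) A `` (act X a ` (collapse_rel (carr X) A `` {m}))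
      = collapse_rel (carr X) A `` {act X a m}"
    by (rule collapse_class_image) (auto simp: act_closed act_stable assms)
  then show ?thesis by (simp add: collapse_def)
qed

lemma pmodule_collapse: "pmodule (collapse X A)"
proof unfold_locales
  show "act (collapse X A) 0 c = pt (collapse X A)" if "c \<in> carr (collapse X A)" for c
  proof -
    from that obtain m where m: "m \<in> carr X" "c = collapse_rel (carr X) A `` {m}"
      by (auto simp: carr_collapse)
    then show ?thesis
      by (simp add: pt_collapse act_class collapse_class_eq_iff act_closed pt_closed act_zero pt_in)
  qed
  show "act (collapse X A) a (pt (collapse X A)) = pt (collapse X A)" for a
    by (simp add: pt_collapse act_class collapse_class_eq_iff act_closed pt_closed act_stable pt_in)
qed (auto simp: carr_collapse pt_collapse act_class act_closed pt_closed act_mult act_one)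

end

text \<open>Equivariance of the inverse is automatic: \<open>f\<close> sends
  \<open>act M a (g k)\<close> to \<open>act N a k\<close>, and applying \<open>g\<close> cancels
  \<open>f\<close>.\<close>

lemma pmodule_isoI:
  assumes hom: "pmodule_hom M N f" and bij: "bij_betw f (carr M) (carr N)"
  shows "M \<simeq>\<^sub>P N"
proof -
  interpret pmodule_hom M N f by fact
  define g where "g = inv_into (carr M) f"
  have g_closed: "g k \<in> carr M" and fg: "f (g k) = k" if "k \<in> carr N" for k
    using that bij by (auto simp: g_def bij_betw_def inv_into_into f_inv_into_f)
  have gf: "g (f m) = m" if "m \<in> carr M" for m
    using that bij by (simp add: g_def bij_betw_def)
  have "pmodule_hom N M g"
  proof unfold_locales
    show "g (pt N) = pt M"
      using gf[OF M.pt_closed] by (simp add: hom_pt)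
    show "g (act N a k) = act M a (g k)" if "k \<in> carr N" for a k
      using that gf[of "act M a (g k)"] by (simp add: hom_act fg g_closed M.act_closed)
  qed (rule g_closed)
  with hom gf fg show ?thesis unfolding pmodule_iso_def by blast
qed

text \<open>Both collapsed sets become basepoints, so bijectivity matters only on the complements
  and equivariance only modulo \<open>B\<close>. Thus \<phi> may identify points of \<open>A\<close>
  and miss points of \<open>B\<close>.\<close>

lemma collapse_iso:
  assumes X: "collapsible X A" and Y: "collapsible Y B"
    and closed: "\<phi> \<in> carr X \<rightarrow> carr Y" and AB: "\<phi> \<in> A \<rightarrow> B"
    and bij: "bij_betw \<phi> (carr X - A) (carr Y - B)"
    and act: "\<And>a x. x \<in> carr X \<Longrightarrow> \<phi> (act X a x) = act Y a (\<phi> x) \<or>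
      \<phi> (act X a x) \<in> B \<and> act Y a (\<phi> x) \<in> B"
  shows "collapse X A \<simeq>\<^sub>P collapse Y B"
proof (rule pmodule_isoI)
  interpret X: collapsible X A by fact
  interpret Y: collapsible Y B by fact
  let ?p = "\<lambda>x. collapse_rel (carr X) A `` {x}" and ?q = "\<lambda>y. collapse_rel (carr Y) B `` {y}"
  \<comment> \<open>Saturating the image of the whole class avoids choosing a
    representative.\<close>
  define f where "f c = collapse_rel (carr Y) B `` (\<phi> ` c)" for c
  have f: "f (?p x) = ?q (\<phi> x)" if "x \<in> carr X" for x
    unfolding f_def by (rule collapse_class_image[OF closed AB that])
  have closed': "\<phi> x \<in> carr Y" if "x \<in> carr X" for x
    using that closed by auto
  have AB': "\<phi> x \<in> B" if "x \<in> A" for x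
    using that AB by auto
  interpret cX: pmodule "collapse X A" by (rule X.pmodule_collapse)
  interpret cY: pmodule "collapse Y B" by (rule Y.pmodule_collapse)
  show "pmodule_hom (collapse X A) (collapse Y B) f"
  proof unfold_locales
    show "f (pt (collapse X A)) = pt (collapse Y B)"
      by (simp add: pt_collapse f X.pt_closed Y.pt_closed closed' collapse_class_eq_iff
          AB' X.pt_in Y.pt_in)
    show "f c \<in> carr (collapse Y B)" if "c \<in> carr (collapse X A)" for c
      using that by (auto simp: carr_collapse f closed')
    show "f (act (collapse X A) a c) = act (collapse Y B) a (f c)"
      if "c \<in> carr (collapse X A)" for a c
    proof -
      from that obtain x where x: "x \<in> carr X" "c = ?p x"
        by (auto simp: carr_collapse)
      have "?q (\<phi> (act X a x)) = ?q (act Y a (\<phi> x))"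
        using act[OF x(1), of a] x(1)
        by (simp add: collapse_class_eq_iff closed' X.act_closed Y.act_closed)
      with x show ?thesis
        by (simp add: X.act_class f Y.act_class closed' X.act_closed)
    qed
  qed
  \<comment> \<open>Points outside \<open>A\<close> land outside \<open>B\<close> because the
    bijection maps complement to complement.\<close>
  have in_iff: "\<phi> x \<in> B \<longleftrightarrow> x \<in> A" if "x \<in> carr X" for x
    using that bij AB' by (auto simp: bij_betw_def)
  have eq_iff: "\<phi> x = \<phi> y \<longleftrightarrow> x = y" if "x \<in> carr X - A" "y \<in> carr X - A" for x y
    using that bij by (auto simp: bij_betw_def inj_on_eq_iff)
  have "inj_on f (carr (collapse X A))"
  proof (rule inj_onI, clarsimp simp: carr_collapse f)
    fix x y assume xy: "x \<in> carr X" "y \<in> carr X" and "?q (\<phi> x) = ?q (\<phi> y)"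
    then have "\<phi> x = \<phi> y \<or> x \<in> A \<and> y \<in> A"
      by (simp add: collapse_class_eq_iff closed' in_iff)
    then have "x = y \<or> x \<in> A \<and> y \<in> A"
      using xy in_iff eq_iff by (metis DiffI)
    then show "?p x = ?p y"
      using xy by (simp add: collapse_class_eq_iff)
  qed
  moreover have "f ` carr (collapse X A) = carr (collapse Y B)"
  proof
    show "f ` carr (collapse X A) \<subseteq> carr (collapse Y B)"
      by (auto simp: carr_collapse f closed')
    show "carr (collapse Y B) \<subseteq> f ` carr (collapse X A)"
    proof (clarsimp simp: carr_collapse image_image f cong: image_cong_simp)
      fix y assume y: "y \<in> carr Y"
      show "?q y \<in> (\<lambda>x. ?q (\<phi> x)) ` carr X"
      proof (cases "y \<in> B")
        case True
        \<comment> \<open>A point of \<open>B\<close> need not have a preimage: its class is the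
          basepoint class, which the basepoint of \<open>X\<close> already hits.\<close>
        then have "?q y = ?q (\<phi> (pt X))"
          using y by (simp add: collapse_class_eq_iff closed' X.pt_closed AB' X.pt_in)
        then show ?thesis using X.pt_closed by blast
      next
        case False
        with y bij have "y \<in> \<phi> ` (carr X - A)"
          by (simp add: bij_betw_def)
        then obtain x where "x \<in> carr X" "\<phi> x = y"
          by blast
        then show ?thesis by blast
      qed
    qed
  qed
  ultimately show "bij_betw f (carr (collapse X A)) (carr (collapse Y B))"
    by (simp add: bij_betw_def)
qed

section \<open>Smash products and direct sums as collapsed quotients\<close>

lemma collapsible_smash:
  assumes "pmodule M" "pmodule N"
  shows "collapsible (pset_prod M N) (carr M \<times> {pt N} \<union> {pt M} \<times> carr N)"
proof -
  interpret M: pmodule M by fact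
  interpret N: pmodule N by fact
  show ?thesis
    by unfold_locales
      (auto simp: pset_prod_def M.pt_closed N.pt_closed M.act_closed N.act_closed M.act_mult
        N.act_mult M.act_one N.act_one M.act_zero N.act_zero M.act_pt N.act_pt)
qed

lemma collapsible_direct_sum:
  assumes "\<And>i. i \<in> I \<Longrightarrow> pmodule (M i)"
  shows "collapsible (disjoint_union I M) (insert None ((\<lambda>i. Some (i, pt (M i))) ` I))"
  using assms
  by unfold_locales
    (auto simp: disjoint_union_def pmodule.act_closed pmodule.act_mult pmodule.act_one
      pmodule.act_zero pmodule.act_pt)

section \<open>Skew shapes, their modules and the comparison map\<close>

lemma vec_int_add: "vec_int (d + e) = vec_int d + vec_int e"
  by (simp add: vec_int_def vec_eq_iff)

lemma vec_int_zero: "vec_int 0 = 0"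
  by (simp add: vec_int_def vec_eq_iff)

lemma vec_int_nonneg: "0 \<le> vec_int e"
  by (simp add: vec_int_def less_eq_vec_def)

lemma shape_act_None: "shape_act S a None = None"
  by (cases a) auto

lemma skew_shape_convex:
  "skew_shape S \<Longrightarrow> a \<in> S \<Longrightarrow> b \<in> S \<Longrightarrow> a \<le> c \<Longrightarrow> c \<le> b \<Longrightarrow> c \<in> S"
  unfolding skew_shape_def by blast

lemma pmodule_shape_module:
  assumes "skew_shape S"
  shows "pmodule (shape_module S)"
proof -
  have mult: "shape_act S (a * b) (Some s) = shape_act S a (shape_act S b (Some s))"
    if s: "s \<in> S" for a b s
  proof (cases a; cases b)
    fix d e assume ab: "a = Monom d" "b = Monom e"
    \<comment> \<open>The intermediate point lies between \<open>s\<close> and the final point, so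
      by convexity acting in two stages cannot reach \<open>None\<close> when the combined action
      stays in \<open>S\<close>.\<close>
    have "s + vec_int e \<in> S" if "s + vec_int (d + e) \<in> S"
    proof (rule skew_shape_convex[OF assms s that])
      show "s \<le> s + vec_int e" "s + vec_int e \<le> s + vec_int (d + e)"
        using vec_int_nonneg[of d] vec_int_nonneg[of e]
        by (simp_all add: vec_int_add less_eq_vec_def)
    qed
    then show ?thesis by (auto simp: ab vec_int_add ac_simps)
  qed (auto simp: shape_act_None)
  have closed: "shape_act S a m \<in> insert None (Some ` S)" for a m
    by (cases "(S, a, m)" rule: shape_act.cases) auto
  show ?thesis
  proof unfold_locales
    show "act (shape_module S) a m \<in> carr (shape_module S)" for a m
      using closed by (simp add: shape_module_def)
    show "act (shape_module S) (a * b) m = act (shape_module S) a (act (shape_module S) b m)"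
      if "m \<in> carr (shape_module S)" for a b m
      using that mult by (auto simp: shape_module_def shape_act_None)
  qed (auto simp: shape_module_def shape_act_None one_pmonoid_def zero_pmonoid_def vec_int_zero)
qed

lemma mem_translate_iff: "x \<in> translate S t \<longleftrightarrow> x - t \<in> S"
proof
  assume "x - t \<in> S"
  then show "x \<in> translate S t"
    unfolding translate_def by (rule rev_image_eqI) simp
qed (auto simp: translate_def)

lemma skew_shape_translate:
  assumes "skew_shape S"
  shows "skew_shape (translate S t)"
proof -
  have "finite (translate S t)"
    using assms by (simp add: skew_shape_def translate_def)
  moreover have "c \<in> translate S t"
    if "a \<in> translate S t" "b \<in> translate S t" "a \<le> c" "c \<le> b" for a b c
    using that skew_shape_convex[OF assms, of "a - t" "b - t" "c - t"]
    by (simp add: mem_translate_iff less_eq_vec_def)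
  ultimately show ?thesis unfolding skew_shape_def by blast
qed

lemma skew_shape_Int:
  assumes "skew_shape S" "skew_shape T"
  shows "skew_shape (S \<inter> T)"
proof -
  have "finite (S \<inter> T)"
    using assms by (simp add: skew_shape_def)
  moreover have "c \<in> S \<inter> T" if "a \<in> S \<inter> T" "b \<in> S \<inter> T" "a \<le> c" "c \<le> b" for a b c
    using that skew_shape_convex[OF assms(1), of a b c] skew_shape_convex[OF assms(2), of a b c]
    by simp
  ultimately show ?thesis unfolding skew_shape_def by blast
qed

text \<open>A pair with a missing coordinate determines no index, so it goes to the extra point
  \<open>None\<close> of the disjoint union rather than to the basepoint of some summand.\<close>

fun diff_index :: "'a::ab_group_add option \<times> 'a option \<Rightarrow> ('a \<times> 'a option) option" where
  "diff_index (Some x, Some y) = Some (x - y, Some x)"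
| "diff_index _ = None"

lemma diff_index_None: "diff_index (x, None) = None"
  by (cases x) auto

theorem theorem1p1:
  fixes S\<^sub>1 S\<^sub>2 :: "(int ^ 'n::finite) set"
  assumes "skew_shape S\<^sub>1" and "skew_shape S\<^sub>2"
  shows "shape_module S\<^sub>1 \<and>\<^sub>P shape_module S\<^sub>2 \<simeq>\<^sub>P
    direct_sum (UNIV :: (int ^ 'n) set) (\<lambda>t. shape_module (S\<^sub>1 \<inter> translate S\<^sub>2 t))"
  unfolding smash_def direct_sum_def
proof (rule collapse_iso[where \<phi> = diff_index])
  let ?X = "pset_prod (shape_module S\<^sub>1) (shape_module S\<^sub>2)"
  let ?A = "carr (shape_module S\<^sub>1) \<times> {pt (shape_module S\<^sub>2)} \<union>
    {pt (shape_module S\<^sub>1)} \<times> carr (shape_module S\<^sub>2)"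
  let ?M = "\<lambda>t. shape_module (S\<^sub>1 \<inter> translate S\<^sub>2 t)"
  let ?Y = "disjoint_union UNIV ?M"
  let ?B = "insert None (range (\<lambda>t. Some (t, pt (?M t))))"
  show "collapsible ?X ?A"
    by (intro collapsible_smash pmodule_shape_module assms)
  show "collapsible ?Y ?B"
    by (intro collapsible_direct_sum pmodule_shape_module skew_shape_Int skew_shape_translate assms)
  show "diff_index \<in> carr ?X \<rightarrow> carr ?Y" "diff_index \<in> ?A \<rightarrow> ?B"
    by (auto simp: pset_prod_def disjoint_union_def shape_module_def mem_translate_iff
        diff_index_None)
  have carrX: "carr ?X - ?A = Some ` S\<^sub>1 \<times> Some ` S\<^sub>2"
    by (auto simp: pset_prod_def shape_module_def)
  have carrY: "carr ?Y - ?B = {Some (t, Some s) |t s. s \<in> S\<^sub>1 \<and> s - t \<in> S\<^sub>2}"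
    by (auto simp: disjoint_union_def shape_module_def mem_translate_iff)
  show "bij_betw diff_index (carr ?X - ?A) (carr ?Y - ?B)"
    unfolding carrX carrY
  proof (rule bij_betw_imageI)
    show "inj_on diff_index (Some ` S\<^sub>1 \<times> Some ` S\<^sub>2)"
      by (auto simp: inj_on_def)
    \<comment> \<open>The index and the first coordinate recover the second one as
      \<open>s - t\<close>.\<close>
    have "Some (t, Some s) \<in> diff_index ` (Some ` S\<^sub>1 \<times> Some ` S\<^sub>2)"
      if "s \<in> S\<^sub>1" "s - t \<in> S\<^sub>2" for s t
      using that by (intro image_eqI[of _ _ "(Some s, Some (s - t))"]) auto
    then show "diff_index ` (Some ` S\<^sub>1 \<times> Some ` S\<^sub>2) = {Some (t, Some s) |t s. s \<in> S\<^sub>1 \<and> s - t \<in> S\<^sub>2}"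
      by auto
  qed
  \<comment> \<open>When a point of index \<open>t\<close> is killed, the left side is
    \<open>None\<close> but the right side is \<open>Some (t, None)\<close>. These differ, yet both
    lie in \<open>?B\<close>, which is the second alternative.\<close>
  show "diff_index (act ?X a x) = act ?Y a (diff_index x) \<or>
      diff_index (act ?X a x) \<in> ?B \<and> act ?Y a (diff_index x) \<in> ?B" if "x \<in> carr ?X" for a x
    by (cases x rule: diff_index.cases; cases a)
      (auto simp: pset_prod_def disjoint_union_def shape_module_def mem_translate_iff
        shape_act_None diff_index_None algebra_simps)
qed

end
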